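(* Let $F$ be an algebraically closed field of characteristic $p>0$, and let $G$ be a finite group of order $|G|=pm$ such that $p$ and $m$ are coprime. Then for a $G$-module $V$ over $F$, we have \[ \delta(G,V)=\begin{cases} 0&\text{if } V^{G}=\{0\},\\ 1&\text{if } V^{G}\ne\{0\} \text{ and } V^{G}\cap V_{0}=\{0\},\\ p&\text{otherwise,} \end{cases} \] where $V_0=\{v\in V\mid f(v)=0\text{ for all } f\in F[V]^G_1=(V^* )^G\}$.
   Context: A $G$-module is a finite dimensional representation of $G$ over $F$. $G$ acts on the polynomial ring $F[V]$ by $\tau(f)=f\circ\tau^{-1}$; $F[V]^G_d$ is the space of homogeneous invariants of degree $d$; $V^G$ is the space of fixed points. For $v\in V\setminus\{0\}$ put $\epsilon(G,v)=\min\{d>0\mid \text{there is } f\in F[V]^G_d \text{ with } f(v)\ne 0\}$. The degree of reductivity $\delta(G,V)$ is defined to be $0$ if $V^G=\{0\}$, and otherwise the supremum of $\epsilon(G,v)$ over all $v\in V^G\setminus\{0\}$. *)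

theory Defs
  imports
    "HOL-Algebra.Group_Action"
    "HOL-Computational_Algebra.Polynomial"
    "HOL-Library.Extended_Nat"
begin

context finite_dimensional_vector_space
begin

text \<open>
  The homogeneous component of degree \<open>d\<close> of the ring of polynomial functions on the space:
  the forms of degree \<open>d\<close> in the coordinates with respect to \<open>Basis\<close>, the function
  \<open>\<alpha>\<close> being the multi-exponent of a monomial. Over an infinite field (such as an algebraically
  closed one) polynomials and polynomial functions are the same, and the component does not
  depend on the choice of \<open>Basis\<close>.
\<close>

definition multi_exponents :: "nat \<Rightarrow> ('b \<Rightarrow> nat) set" where
  "multi_exponents d = {\<alpha>. (\<forall>b. b \<notin> Basis \<longrightarrow> \<alpha> b = 0) \<and> (\<Sum>b\<in>Basis. \<alpha> b) = d}"

definition homogeneous_polys :: "nat \<Rightarrow> ('b \<Rightarrow> 'a) set" where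
  "homogeneous_polys d =
     {f. \<exists>c. f = (\<lambda>v. \<Sum>\<alpha>\<in>multi_exponents d. c \<alpha> * (\<Prod>b\<in>Basis. representation Basis v b ^ \<alpha> b))}"

end

locale G_module =
  finite_dimensional_vector_space scale Basis + group_action G "UNIV :: 'b set" \<rho>
  for scale :: "'a::field \<Rightarrow> 'b::ab_group_add \<Rightarrow> 'b" (infixr \<open>*s\<close> 75)
    and Basis :: "'b set"
    and G :: "('g, 'm) monoid_scheme" (structure)
    and \<rho> :: "'g \<Rightarrow> 'b \<Rightarrow> 'b" +
  assumes linear_action: "g \<in> carrier G \<Longrightarrow> Vector_Spaces.linear scale scale (\<rho> g)"
begin

definition poly_action :: "'g \<Rightarrow> ('b \<Rightarrow> 'a) \<Rightarrow> ('b \<Rightarrow> 'a)" where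
  "poly_action g f = f \<circ> \<rho> (inv g)"

definition invariants :: "nat \<Rightarrow> ('b \<Rightarrow> 'a) set" where
  "invariants d = {f \<in> homogeneous_polys d. \<forall>g\<in>carrier G. poly_action g f = f}"

definition fixed_points :: "'b set" where
  "fixed_points = {v. \<forall>g\<in>carrier G. \<rho> g v = v}"

text \<open>
  Values are taken in \<^typ>\<open>enat\<close> so that a minimum over the empty set and the supremum of an
  unbounded set are \<open>\<infinity>\<close>; an infimum over a nonempty set of extended naturals is its minimum.
\<close>

definition epsilon :: "'b \<Rightarrow> enat" where
  "epsilon v = (INF d\<in>{d. d > 0 \<and> (\<exists>f\<in>invariants d. f v \<noteq> 0)}. enat d)"

definition degree_of_reductivity :: enat where
  "degree_of_reductivity =
     (if fixed_points = {0} then 0 else (SUP v\<in>fixed_points - {0}. epsilon v))"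

definition linear_null_set :: "'b set" where
  "linear_null_set = {v. \<forall>f\<in>invariants 1. f v = 0}"

end

end

theory Submission
  imports Defs "HOL-Algebra.Exponent"
begin

text \<open>
  Let \<open>v\<close> be a nonzero fixed point. If \<open>f\<close> is an invariant of degree \<open>d\<close>, its differential at \<open>v\<close>
  is an invariant linear form, because \<open>v\<close> is fixed, and by Euler's formula its value at \<open>v\<close> is
  \<open>d f(v)\<close>. So if all invariant linear forms vanish at \<open>v\<close> but \<open>f(v) \<noteq> 0\<close>, then \<open>p\<close> divides \<open>d\<close>.
  Conversely, for a linear form \<open>l\<close> with \<open>l(v) \<noteq> 0\<close>, the \<open>p\<close>-th elementary symmetric polynomial
  in the translates of \<open>l\<close> by the \<open>pm\<close> elements of \<open>G\<close> is an invariant of degree \<open>p\<close>. Its value at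
  \<open>v\<close> is \<open>l(v)\<^sup>p\<close> times the binomial coefficient \<open>pm\<close> over \<open>p\<close>, which is prime to \<open>p\<close>.
\<close>

section \<open>Infinite fields and a binomial coefficient\<close>

lemma infinite_UNIV_alg_closed_field: "infinite (UNIV :: 'a::alg_closed_field set)"
proof
  assume fin: "finite (UNIV :: 'a set)"
  \<comment> \<open>Over a finite field this product vanishes at every point, so
    \<open>q + 1\<close> has positive degree but no root.\<close>
  define q :: "'a poly" where "q = (\<Prod>a\<in>UNIV. [:- a, 1:])"
  have "degree q = card (UNIV :: 'a set)"
    unfolding q_def by (subst degree_prod_eq_sum_degree) auto
  then have "degree (q + 1) > 0"
    using fin by (subst degree_add_eq_left) (auto simp: finite_UNIV_card_ge_0)
  then obtain x where "poly (q + 1) x = 0"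
    using alg_closed_imp_poly_has_root by blast
  moreover have "poly q x = 0"
    unfolding q_def poly_prod using fin by (intro prod_zero) auto
  ultimately show False by simp
qed

lemma poly_eqI_infinite:
  fixes p q :: "'a::idom poly"
  assumes "infinite (UNIV :: 'a set)" and "\<And>x. poly p x = poly q x"
  shows "p = q"
  using assms poly_roots_finite[of "p - q"] by auto

text \<open>By the computation behind Sylow's theorem, \<open>p * m choose p\<close> has the same
  \<open>p\<close>-adic multiplicity as \<open>m\<close>, namely 0.\<close>

lemma prime_not_dvd_binomial:
  assumes "prime p" and "coprime p m"
  shows "\<not> p dvd (p * m choose p)"
proof -
  have m: "m > 0" "\<not> p dvd m"
    using assms by (auto intro: Nat.gr0I simp: prime_imp_coprime_nat coprime_absorb_left)
  have "multiplicity p (p ^ 1 * m choose p ^ 1) = multiplicity p m"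
    by (rule const_p_fac) (use assms m in auto)
  with m have "multiplicity p (p * m choose p) = 0"
    by (simp add: not_dvd_imp_multiplicity_0)
  moreover have "(p * m choose p) \<noteq> 0"
    using m by simp
  ultimately show ?thesis
    using assms(1) by (metis multiplicity_eq_zero_iff not_prime_unit)
qed

section \<open>Homogeneous polynomial functions and their differentials\<close>

context finite_dimensional_vector_space
begin

lemma finite_multi_exponents: "finite (multi_exponents d)"
proof (rule finite_subset)
  show "multi_exponents d \<subseteq> {\<alpha>. \<forall>b. (b \<in> Basis \<longrightarrow> \<alpha> b \<in> {..d}) \<and> (b \<notin> Basis \<longrightarrow> \<alpha> b = 0)}"
    using finite_Basis by (auto simp: multi_exponents_def intro: member_le_sum)
  show "finite \<dots>"
    by (rule finite_set_of_finite_funs) (use finite_Basis in auto)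
qed

lemma homogeneous_polys_zero: "(\<lambda>v. 0) \<in> homogeneous_polys d"
  unfolding homogeneous_polys_def by (auto intro!: exI[of _ "\<lambda>_. 0"])

lemma homogeneous_polys_add:
  assumes "f \<in> homogeneous_polys d" and "g \<in> homogeneous_polys d"
  shows "(\<lambda>v. f v + g v) \<in> homogeneous_polys d"
proof -
  obtain c c' where
    "f = (\<lambda>v. \<Sum>\<alpha>\<in>multi_exponents d. c \<alpha> * (\<Prod>b\<in>Basis. representation Basis v b ^ \<alpha> b))"
    "g = (\<lambda>v. \<Sum>\<alpha>\<in>multi_exponents d. c' \<alpha> * (\<Prod>b\<in>Basis. representation Basis v b ^ \<alpha> b))"
    using assms unfolding homogeneous_polys_def by blast
  then have "(\<lambda>v. f v + g v) = (\<lambda>v. \<Sum>\<alpha>\<in>multi_exponents d.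
      (c \<alpha> + c' \<alpha>) * (\<Prod>b\<in>Basis. representation Basis v b ^ \<alpha> b))"
    by (simp add: algebra_simps sum.distrib)
  then show ?thesis
    unfolding homogeneous_polys_def by (intro CollectI exI[of _ "\<lambda>\<alpha>. c \<alpha> + c' \<alpha>"])
qed

lemma homogeneous_polys_sum:
  assumes "\<And>i. i \<in> I \<Longrightarrow> f i \<in> homogeneous_polys d"
  shows "(\<lambda>v. \<Sum>i\<in>I. f i v) \<in> homogeneous_polys d"
  using assms
  by (induction I rule: infinite_finite_induct)
    (auto intro: homogeneous_polys_zero homogeneous_polys_add)

lemma homogeneous_polys_monomial:
  assumes "\<alpha> \<in> multi_exponents d"
  shows "(\<lambda>v. c * (\<Prod>b\<in>Basis. representation Basis v b ^ \<alpha> b)) \<in> homogeneous_polys d"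
  unfolding homogeneous_polys_def
  using assms finite_multi_exponents
  by (auto intro!: exI[of _ "\<lambda>\<beta>. if \<beta> = \<alpha> then c else 0"] simp: if_distrib[of "\<lambda>x. x * _"] sum.delta
      cong: if_cong)

lemma homogeneous_polys_mult:
  assumes "f \<in> homogeneous_polys d" and "g \<in> homogeneous_polys e"
  shows "(\<lambda>v. f v * g v) \<in> homogeneous_polys (d + e)"
proof -
  obtain c c' where fg:
    "f = (\<lambda>v. \<Sum>\<alpha>\<in>multi_exponents d. c \<alpha> * (\<Prod>b\<in>Basis. representation Basis v b ^ \<alpha> b))"
    "g = (\<lambda>v. \<Sum>\<alpha>\<in>multi_exponents e. c' \<alpha> * (\<Prod>b\<in>Basis. representation Basis v b ^ \<alpha> b))"
    using assms unfolding homogeneous_polys_def by blast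
  have eq: "(\<lambda>v. f v * g v) = (\<lambda>v. \<Sum>\<alpha>\<in>multi_exponents d. \<Sum>\<beta>\<in>multi_exponents e.
      (c \<alpha> * c' \<beta>) * (\<Prod>b\<in>Basis. representation Basis v b ^ (\<lambda>b. \<alpha> b + \<beta> b) b))"
    unfolding fg sum_product by (simp add: power_add prod.distrib mult_ac)
  show ?thesis
    unfolding eq
    by (intro homogeneous_polys_sum homogeneous_polys_monomial)
      (auto simp: multi_exponents_def sum.distrib)
qed

lemma homogeneous_polys_const: "(\<lambda>v. c) \<in> homogeneous_polys 0"
  using homogeneous_polys_monomial[of "\<lambda>_. 0" 0 c] by (simp add: multi_exponents_def)

lemma homogeneous_polys_prod:
  assumes "finite I" and "\<And>i. i \<in> I \<Longrightarrow> f i \<in> homogeneous_polys 1"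
  shows "(\<lambda>v. \<Prod>i\<in>I. f i v) \<in> homogeneous_polys (card I)"
  using assms
proof (induction I rule: finite_induct)
  case empty
  then show ?case by (simp add: homogeneous_polys_const)
next
  case (insert i I)
  then show ?case
    using homogeneous_polys_mult[of "f i" 1 "\<lambda>v. \<Prod>i\<in>I. f i v" "card I"] by simp
qed

lemma homogeneous_polys_coordinate:
  assumes "a \<in> Basis"
  shows "(\<lambda>v. representation Basis v a) \<in> homogeneous_polys 1"
proof -
  have "(\<lambda>b. if b = a then 1 else 0) \<in> multi_exponents 1"
    using assms finite_Basis by (auto simp: multi_exponents_def)
  from homogeneous_polys_monomial[OF this, of 1] show ?thesis
    using assms finite_Basis by (simp add: if_distrib[of "\<lambda>n. _ ^ n"] prod.delta cong: if_cong)
qed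

lemma representation_Basis_add:
  "representation Basis (u + v) b = representation Basis u b + representation Basis v b"
  by (simp add: representation_add independent_Basis span_Basis)

lemma representation_Basis_scale:
  "representation Basis (r *s v) b = r * representation Basis v b"
  by (simp add: representation_scale independent_Basis span_Basis)

text \<open>This shape fits both the matrix expansion of a coordinate of \<open>h v\<close> and the
  differential of a form, with \<open>k b\<close> a matrix entry or a partial derivative.\<close>

lemma homogeneous_polys_linear_form:
  "(\<lambda>v. \<Sum>b\<in>Basis. representation Basis v b * k b) \<in> homogeneous_polys 1"
proof (rule homogeneous_polys_sum)
  fix b assume "b \<in> Basis"
  then show "(\<lambda>v. representation Basis v b * k b) \<in> homogeneous_polys 1"
    using homogeneous_polys_mult[OF homogeneous_polys_coordinate homogeneous_polys_const] by simp
qed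

lemma coordinate_linear_expand:
  assumes "Vector_Spaces.linear scale scale h"
  shows "representation Basis (h v) a =
    (\<Sum>b\<in>Basis. representation Basis v b * representation Basis (h b) a)"
proof -
  interpret h: Vector_Spaces.linear scale scale h by fact
  have "h v = h (\<Sum>b\<in>Basis. representation Basis v b *s b)"
    by (simp add: sum_representation_eq independent_Basis span_Basis finite_Basis)
  also have "\<dots> = (\<Sum>b\<in>Basis. representation Basis v b *s h b)"
    by (simp add: h.sum h.scale)
  finally show ?thesis
    by (simp add: representation_sum independent_Basis span_Basis representation_Basis_scale)
qed

lemma homogeneous_polys_coordinate_linear:
  assumes "Vector_Spaces.linear scale scale h"
  shows "(\<lambda>v. representation Basis (h v) a) \<in> homogeneous_polys 1"
  by (subst coordinate_linear_expand[OF assms]) (rule homogeneous_polys_linear_form)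

lemma homogeneous_polys_scale:
  assumes "f \<in> homogeneous_polys d"
  shows "f (r *s v) = r ^ d * f v"
proof -
  obtain c where
    f: "f = (\<lambda>v. \<Sum>\<alpha>\<in>multi_exponents d. c \<alpha> * (\<Prod>b\<in>Basis. representation Basis v b ^ \<alpha> b))"
    using assms unfolding homogeneous_polys_def by blast
  have "(\<Prod>b\<in>Basis. r ^ \<alpha> b) = r ^ d" if "\<alpha> \<in> multi_exponents d" for \<alpha>
    using that by (simp add: multi_exponents_def flip: power_sum)
  then show ?thesis
    by (simp add: f representation_Basis_scale power_mult_distrib prod.distrib sum_distrib_left
        mult_ac cong: sum.cong)
qed

text \<open>The coefficient of \<open>t\<close> in \<open>f(v + t w)\<close> is the differential of \<open>f\<close> at \<open>v\<close>, applied to \<open>w\<close>.\<close>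

lemma homogeneous_polys_line:
  assumes "f \<in> homogeneous_polys d"
  obtains q k where "\<And>w t. poly (q w) t = f (v + t *s w)"
    and "\<And>w. coeff (q w) 1 = (\<Sum>b\<in>Basis. representation Basis w b * k b)"
proof -
  obtain c where
    f: "f = (\<lambda>v. \<Sum>\<alpha>\<in>multi_exponents d. c \<alpha> * (\<Prod>b\<in>Basis. representation Basis v b ^ \<alpha> b))"
    using assms unfolding homogeneous_polys_def by blast
  let ?r = "representation Basis"
  \<comment> \<open>\<open>q w\<close> is \<open>f\<close> with each coordinate replaced by the
    corresponding affine polynomial in \<open>t\<close> along the line through \<open>v\<close> with
    direction \<open>w\<close>.\<close>
  define q where "q w = (\<Sum>\<alpha>\<in>multi_exponents d.
    [:c \<alpha>:] * (\<Prod>b\<in>Basis. [:?r v b, ?r w b:] ^ \<alpha> b))" for w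
  \<comment> \<open>\<open>k b\<close> is the partial derivative of \<open>f\<close> at
    \<open>v\<close> along \<open>b\<close>. If \<open>\<alpha> b = 0\<close>, the truncated
    exponent does no harm, since the factor \<open>of_nat (\<alpha> b)\<close> vanishes.\<close>
  define k where "k b = (\<Sum>\<alpha>\<in>multi_exponents d. c \<alpha> *
    ((\<Prod>a\<in>Basis - {b}. ?r v a ^ \<alpha> a) * (of_nat (\<alpha> b) * ?r v b ^ (\<alpha> b - 1))))" for b
  show thesis
  proof
    show "poly (q w) t = f (v + t *s w)" for w t
      by (simp add: q_def f poly_sum poly_prod representation_Basis_add representation_Basis_scale)
    show "coeff (q w) 1 = (\<Sum>b\<in>Basis. ?r w b * k b)" for w
    proof -
      \<comment> \<open>Passing to the derivative at 0 makes the product rule available.\<close>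
      have "coeff (q w) 1 = poly (pderiv (q w)) 0"
        by (simp add: poly_0_coeff_0 coeff_pderiv)
      also have "\<dots> = (\<Sum>\<alpha>\<in>multi_exponents d. c \<alpha> * (\<Sum>b\<in>Basis. ?r w b *
          ((\<Prod>a\<in>Basis - {b}. ?r v a ^ \<alpha> a) * (of_nat (\<alpha> b) * ?r v b ^ (\<alpha> b - 1)))))"
        by (simp add: q_def higher_pderiv_sum[of "Suc 0", simplified] pderiv_smult
            pderiv_prod pderiv_power pderiv_pCons poly_sum poly_prod mult_ac)
      also have "\<dots> = (\<Sum>b\<in>Basis. ?r w b * k b)"
        unfolding k_def sum_distrib_left by (subst sum.swap) (simp add: mult_ac)
      finally show ?thesis .
    qed
  qed
qed

end

section \<open>Invariants and fixed points\<close>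

context G_module
begin

lemma group_G: "group G"
  using group_hom group_hom.axioms(1) by blast

lemma invariants_iff:
  "f \<in> invariants d \<longleftrightarrow> f \<in> homogeneous_polys d \<and> (\<forall>g\<in>carrier G. \<forall>w. f (\<rho> g w) = f w)"
proof -
  interpret group G by (rule group_G)
  have "(\<forall>g\<in>carrier G. f \<circ> \<rho> (inv g) = f) \<longleftrightarrow> (\<forall>g\<in>carrier G. f \<circ> \<rho> g = f)"
    by (metis inv_closed inv_inv)
  then show ?thesis
    by (auto simp: invariants_def poly_action_def fun_eq_iff)
qed

lemma linear_null_set_char_dvd:
  assumes inf: "infinite (UNIV :: 'a set)"
    and v: "v \<in> fixed_points" "v \<in> linear_null_set"
    and f: "f \<in> invariants d" "f v \<noteq> 0"
  shows "CHAR('a) dvd d"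
proof -
  have hom: "f \<in> homogeneous_polys d" and inv: "\<And>g w. g \<in> carrier G \<Longrightarrow> f (\<rho> g w) = f w"
    using f(1) by (auto simp: invariants_iff)
  obtain q k where q: "\<And>w t. poly (q w) t = f (v + t *s w)"
    and k: "\<And>w. coeff (q w) 1 = (\<Sum>b\<in>Basis. representation Basis w b * k b)"
    using homogeneous_polys_line[OF hom, of v] by blast
  have "(\<lambda>w. coeff (q w) 1) \<in> homogeneous_polys 1"
    unfolding k by (rule homogeneous_polys_linear_form)
  \<comment> \<open>As \<open>v\<close> is fixed, \<open>\<rho> g\<close> carries the line through
    \<open>v\<close> with direction \<open>w\<close> to the one with direction
    \<open>\<rho> g w\<close>; \<open>f\<close> takes the same values on both.\<close>
  moreover have "q (\<rho> g w) = q w" if g: "g \<in> carrier G" for g w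
  proof (rule poly_eqI_infinite[OF inf])
    fix t
    interpret h: Vector_Spaces.linear scale scale "\<rho> g"
      by (rule linear_action[OF g])
    have "\<rho> g (v + t *s w) = v + t *s \<rho> g w"
      using v g by (simp add: h.add h.scale fixed_points_def)
    then show "poly (q (\<rho> g w)) t = poly (q w) t"
      using inv[OF g, of "v + t *s w"] by (simp add: q)
  qed
  ultimately have "(\<lambda>w. coeff (q w) 1) \<in> invariants 1"
    by (simp add: invariants_iff)
  then have "coeff (q v) 1 = 0"
    using v by (auto simp: linear_null_set_def)
  \<comment> \<open>Euler's formula in disguise: along the direction \<open>v\<close> itself,
    homogeneity gives \<open>f(v + t v) = (1 + t)^d f(v)\<close>.\<close>
  moreover have "q v = smult (f v) ([:1, 1:] ^ d)"
  proof (rule poly_eqI_infinite[OF inf])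
    fix t
    have "v + t *s v = (1 + t) *s v"
      by (simp add: scale_left_distrib)
    then show "poly (q v) t = poly (smult (f v) ([:1, 1:] ^ d)) t"
      by (simp add: q homogeneous_polys_scale[OF hom])
  qed
  then have "coeff (q v) 1 = f v * of_nat d"
    by (cases d) (simp_all add: coeff_linear_poly_power del: power_Suc)
  ultimately show ?thesis
    using f(2) by (simp add: of_nat_eq_0_iff_char_dvd)
qed

text \<open>The binomial coefficient counts the terms of the elementary symmetric polynomial, which
  all take the same nonzero value at \<open>v\<close>.\<close>

lemma elementary_symmetric_invariant:
  assumes fin: "finite (carrier G)"
    and v: "v \<in> fixed_points" "v \<noteq> 0"
    and n: "of_nat (Coset.order G choose n) \<noteq> (0::'a)"
  obtains f where "f \<in> invariants n" and "f v \<noteq> 0"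
proof -
  interpret group G by (rule group_G)
  \<comment> \<open>The coordinate at \<open>a\<close> serves as the linear form that does not
    vanish at \<open>v\<close>.\<close>
  obtain a where a: "a \<in> Basis" "representation Basis v a \<noteq> 0"
  proof (rule ccontr)
    assume "\<not> thesis"
    then have "(\<Sum>b\<in>Basis. representation Basis v b *s b) = 0"
      using that by (intro sum.neutral) auto
    then show False
      using v(2) by (simp add: sum_representation_eq independent_Basis span_Basis finite_Basis)
  qed
  let ?l = "\<lambda>w. representation Basis w a"
  let ?S = "{S. S \<subseteq> carrier G \<and> card S = n}"
  define f where "f w = (\<Sum>S\<in>?S. \<Prod>g\<in>S. ?l (\<rho> g w))" for w
  have "(\<lambda>w. \<Sum>S\<in>?S. \<Prod>g\<in>S. ?l (\<rho> g w)) \<in> homogeneous_polys n"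
  proof (rule homogeneous_polys_sum)
    fix S assume S: "S \<in> ?S"
    then have "finite S"
      using fin finite_subset by blast
    moreover have "(\<lambda>w. ?l (\<rho> g w)) \<in> homogeneous_polys 1" if "g \<in> S" for g
      using that S by (intro homogeneous_polys_coordinate_linear linear_action) blast
    ultimately show "(\<lambda>w. \<Prod>g\<in>S. ?l (\<rho> g w)) \<in> homogeneous_polys n"
      using homogeneous_polys_prod[of S "\<lambda>g w. ?l (\<rho> g w)"] S by auto
  qed
  moreover have "f (\<rho> h w) = f w" if h: "h \<in> carrier G" for h w
  proof -
    have inj: "inj_on (\<lambda>g. g \<otimes> x) S" if "S \<subseteq> carrier G" "x \<in> carrier G" for S x
      using that by (intro inj_onI) (metis right_cancel subsetD)
    have cancel: "(\<lambda>g. g \<otimes> y) ` (\<lambda>g. g \<otimes> x) ` S = S"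
      if "S \<subseteq> carrier G" "x \<in> carrier G" "y \<in> carrier G" "x \<otimes> y = \<one>" for S x y
    proof -
      have "g \<otimes> x \<otimes> y = g" if "g \<in> S" for g
        using that \<open>S \<subseteq> carrier G\<close> \<open>x \<in> _\<close> \<open>y \<in> _\<close> \<open>x \<otimes> y = \<one>\<close> by (simp add: m_assoc subset_iff)
      then show ?thesis by (simp add: image_image)
    qed
    have "f (\<rho> h w) = (\<Sum>S\<in>?S. \<Prod>g\<in>S. ?l (\<rho> (g \<otimes> h) w))"
      unfolding f_def
      by (intro sum.cong prod.cong refl) (use h in \<open>auto simp: composition_rule subset_iff\<close>)
    \<comment> \<open>Right translation by \<open>h\<close> permutes the \<open>n\<close>-element
      subsets of the group, with inverse the translation by \<open>inv h\<close>.\<close>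
    also have "\<dots> = f w"
      unfolding f_def
    proof (rule sum.reindex_bij_witness[where j = "\<lambda>S. (\<lambda>g. g \<otimes> h) ` S"
          and i = "\<lambda>S. (\<lambda>g. g \<otimes> inv h) ` S"])
      fix S assume S: "S \<in> ?S"
      show "(\<lambda>g. g \<otimes> inv h) ` (\<lambda>g. g \<otimes> h) ` S = S" "(\<lambda>g. g \<otimes> h) ` (\<lambda>g. g \<otimes> inv h) ` S = S"
        using S h by (simp_all add: cancel)
      show "(\<lambda>g. g \<otimes> h) ` S \<in> ?S" "(\<lambda>g. g \<otimes> inv h) ` S \<in> ?S"
        using S h by (auto simp: card_image[OF inj])
      show "(\<Prod>g\<in>(\<lambda>g. g \<otimes> h) ` S. ?l (\<rho> g w)) = (\<Prod>g\<in>S. ?l (\<rho> (g \<otimes> h) w))"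
        using S h by (subst prod.reindex) (auto intro: inj)
    qed
    finally show ?thesis .
  qed
  ultimately have "f \<in> invariants n"
    unfolding invariants_iff f_def by blast
  moreover have "f v = (\<Sum>S\<in>?S. ?l v ^ n)"
    unfolding f_def
  proof (intro sum.cong refl)
    fix S assume "S \<in> ?S"
    moreover from this have "(\<Prod>g\<in>S. ?l (\<rho> g v)) = (\<Prod>g\<in>S. ?l v)"
      using v(1) by (intro prod.cong) (auto simp: fixed_points_def)
    ultimately show "(\<Prod>g\<in>S. ?l (\<rho> g v)) = ?l v ^ n"
      by simp
  qed
  then have "f v = of_nat (Coset.order G choose n) * ?l v ^ n"
    by (simp add: n_subsets[OF fin] Coset.order_def)
  ultimately show thesis
    using that n a(2) by simp
qed

section \<open>Values of \<open>epsilon\<close> and their supremum\<close>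

lemma epsilon_le:
  assumes "f \<in> invariants d" and "d > 0" and "f v \<noteq> 0"
  shows "epsilon v \<le> enat d"
  unfolding epsilon_def using assms by (intro INF_lower) auto

lemma one_le_epsilon: "1 \<le> epsilon v"
  unfolding epsilon_def by (intro INF_greatest) (auto simp: one_enat_def)

lemma epsilon_eq_1:
  assumes "v \<notin> linear_null_set"
  shows "epsilon v = 1"
  using assms one_le_epsilon[of v] epsilon_le[of _ 1 v]
  by (auto simp: linear_null_set_def one_enat_def)

text \<open>The elementary symmetric invariant gives the upper bound, and divisibility by the
  characteristic the lower one.\<close>

lemma epsilon_eq_char:
  assumes "infinite (UNIV :: 'a set)" and "CHAR('a) = p" and "p > 0"
    and "finite (carrier G)" and "Coset.order G = p * m" and "coprime p m"
    and v: "v \<in> fixed_points" "v \<noteq> 0" "v \<in> linear_null_set"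
  shows "epsilon v = enat p"
proof (rule antisym)
  \<comment> \<open>A positive characteristic of a field is prime.\<close>
  have "prime p"
    using assms prime_CHAR_semidom[where 'a = 'a] by simp
  then have "of_nat (Coset.order G choose p) \<noteq> (0::'a)"
    using assms prime_not_dvd_binomial[of p m] by (simp add: of_nat_eq_0_iff_char_dvd)
  then obtain f where "f \<in> invariants p" "f v \<noteq> 0"
    using elementary_symmetric_invariant[OF assms(4) v(1,2)] by blast
  then show "epsilon v \<le> enat p"
    using assms(3) by (intro epsilon_le)
  \<comment> \<open>The infimum runs over positive degrees only, so \<open>p dvd d\<close> yields
    \<open>p \<le> d\<close>.\<close>
  show "enat p \<le> epsilon v"
    unfolding epsilon_def
    using linear_null_set_char_dvd[OF assms(1) v(1,3)] assms(2)
    by (intro INF_greatest) (auto intro: dvd_imp_le)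
qed

lemma zero_in_fixed_points: "0 \<in> fixed_points"
  using module_hom.zero[OF linear_action[unfolded linear_iff_module_hom]]
  by (auto simp: fixed_points_def)

lemma zero_in_linear_null_set: "0 \<in> linear_null_set"
  using homogeneous_polys_scale[of _ 1 0 0]
  by (auto simp: linear_null_set_def invariants_iff)

lemma degree_of_reductivity_eq:
  assumes "infinite (UNIV :: 'a set)" and "CHAR('a) = p" and "p > 0"
    and "finite (carrier G)" and "Coset.order G = p * m" and "coprime p m"
  shows "degree_of_reductivity =
    (if fixed_points = {0} then 0 else if fixed_points \<inter> linear_null_set = {0} then 1 else enat p)"
proof -
  note eps = epsilon_eq_char[OF assms]
  show ?thesis
  proof (cases "fixed_points = {0}")
    case True
    then show ?thesis by (simp add: degree_of_reductivity_def)
  next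
    case nz: False
    \<comment> \<open>Nonemptiness matters: in \<open>enat\<close> the supremum of the empty set is
      0, not 1.\<close>
    then have ne: "fixed_points - {0} \<noteq> {}"
      using zero_in_fixed_points by auto
    show ?thesis
    proof (cases "fixed_points \<inter> linear_null_set = {0}")
      case True
      then have "epsilon v = 1" if "v \<in> fixed_points - {0}" for v
        using that by (intro epsilon_eq_1) auto
      then have "(SUP v\<in>fixed_points - {0}. epsilon v) = 1"
        using ne by (intro SUP_eq_const) auto
      with nz True show ?thesis by (simp add: degree_of_reductivity_def)
    next
      case False
      \<comment> \<open>Both sets contain 0, so an intersection other than \<open>{0}\<close> has a
        nonzero element. The supremum is attained there, as \<open>epsilon\<close> is 1 off
        \<open>linear_null_set\<close> and \<open>p\<close> at its nonzero fixed points.\<close>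
      then obtain u where u: "u \<in> fixed_points" "u \<noteq> 0" "u \<in> linear_null_set"
        using zero_in_fixed_points zero_in_linear_null_set by auto
      have "epsilon v \<le> enat p" if "v \<in> fixed_points - {0}" for v
        using that eps[of v] epsilon_eq_1[of v] assms(3)
        by (cases "v \<in> linear_null_set") (auto simp: one_enat_def)
      then have "(SUP v\<in>fixed_points - {0}. epsilon v) = enat p"
        using u eps[OF u] by (intro antisym SUP_least SUP_upper2[of u]) auto
      with nz False show ?thesis by (simp add: degree_of_reductivity_def)
    qed
  qed
qed

end

theorem proposition18:
  fixes scale :: "'f::alg_closed_field \<Rightarrow> 'v::ab_group_add \<Rightarrow> 'v"
    and Basis :: "'v set"
    and G :: "('g, 'm) monoid_scheme"
    and \<rho> :: "'g \<Rightarrow> 'v \<Rightarrow> 'v"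
    and p m :: nat
  assumes "CHAR('f) = p" and "p > 0"
    and "finite (carrier G)" and "Coset.order G = p * m" and "coprime p m"
    and "G_module scale Basis G \<rho>"
  shows "G_module.degree_of_reductivity scale Basis G \<rho> =
    (if G_module.fixed_points G \<rho> = {0} then 0
     else if G_module.fixed_points G \<rho> \<inter> G_module.linear_null_set scale Basis G \<rho> = {0} then 1
     else enat p)"
  by (rule G_module.degree_of_reductivity_eq[OF assms(6) infinite_UNIV_alg_closed_field assms(1-5)])

end
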